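(* Every $n$-vertex quadrangulation has an edge guard set of size at most $\lfloor n/3 \rfloor$.
   Context: A plane graph is a simple graph together with a crossing-free embedding in $\mathbb{R}^2$. A quadrangulation is a plane graph in which every face (including the outer face) is bounded by a $4$-cycle. For a plane graph $G=(V,E)$, a face $f$ is guarded by an edge $vw \in E$ if at least one of $v,w$ lies on the boundary of $f$. A set $\Gamma \subseteq E$ is an edge guard set if every face of $G$ (including the outer face) is guarded by some edge of $\Gamma$. *)

theory Defs
  imports "HOL-Analysis.Analysis"
begin

text \<open>
  The plane is the type \<^typ>\<open>complex\<close>, as in the library's Jordan curve theorem.  A plane graph is
  a finite simple graph with vertex set \<open>V\<close> and edge set \<open>E\<close> (two-element subsets of \<open>V\<close>), where
  vertex \<open>v\<close> is drawn as the point \<open>pos v\<close> and edge \<open>e\<close> as the simple arc parametrised by \<open>curve e\<close>.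
\<close>

locale plane_graph =
  fixes V :: "'a set"
    and E :: "'a set set"
    and pos :: "'a \<Rightarrow> complex"
    and curve :: "'a set \<Rightarrow> real \<Rightarrow> complex"
  assumes finite_vertices: "finite V"
    and edges: "e \<in> E \<Longrightarrow> e \<subseteq> V \<and> card e = 2"
    and pos_inj: "inj_on pos V"
    and curve_arc: "e \<in> E \<Longrightarrow> arc (curve e)"
    and curve_ends: "e \<in> E \<Longrightarrow> {pathstart (curve e), pathfinish (curve e)} = pos ` e"
    and vertex_on_curve: "e \<in> E \<Longrightarrow> v \<in> V \<Longrightarrow> pos v \<in> path_image (curve e) \<Longrightarrow> v \<in> e"
    and crossing_free: "e \<in> E \<Longrightarrow> e' \<in> E \<Longrightarrow> e \<noteq> e' \<Longrightarrow>
      path_image (curve e) \<inter> path_image (curve e') \<subseteq> pos ` (e \<inter> e')"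

definition drawing ::
    "'a set \<Rightarrow> 'a set set \<Rightarrow> ('a \<Rightarrow> complex) \<Rightarrow> ('a set \<Rightarrow> real \<Rightarrow> complex) \<Rightarrow> complex set" where
  "drawing V E pos curve = pos ` V \<union> (\<Union>e\<in>E. path_image (curve e))"

text \<open>The unbounded component of the complement, i.e. the outer face, is included.\<close>

definition faces ::
    "'a set \<Rightarrow> 'a set set \<Rightarrow> ('a \<Rightarrow> complex) \<Rightarrow> ('a set \<Rightarrow> real \<Rightarrow> complex) \<Rightarrow> complex set set" where
  "faces V E pos curve = components (- drawing V E pos curve)"

definition bounded_by_4_cycle ::
    "'a set set \<Rightarrow> ('a set \<Rightarrow> real \<Rightarrow> complex) \<Rightarrow> complex set \<Rightarrow> bool" where
  "bounded_by_4_cycle E curve f \<longleftrightarrow>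
    (\<exists>a b c d. distinct [a, b, c, d] \<and> {{a, b}, {b, c}, {c, d}, {d, a}} \<subseteq> E \<and>
      frontier f = (\<Union>e\<in>{{a, b}, {b, c}, {c, d}, {d, a}}. path_image (curve e)))"

locale quadrangulation = plane_graph +
  assumes face_4_cycle: "f \<in> faces V E pos curve \<Longrightarrow> bounded_by_4_cycle E curve f"

definition guards :: "('a \<Rightarrow> complex) \<Rightarrow> 'a set \<Rightarrow> complex set \<Rightarrow> bool" where
  "guards pos e f \<longleftrightarrow> (\<exists>v\<in>e. pos v \<in> frontier f)"

definition edge_guard_set ::
    "'a set \<Rightarrow> 'a set set \<Rightarrow> ('a \<Rightarrow> complex) \<Rightarrow> ('a set \<Rightarrow> real \<Rightarrow> complex) \<Rightarrow> 'a set set \<Rightarrow> bool" where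
  "edge_guard_set V E pos curve \<Gamma> \<longleftrightarrow>
    \<Gamma> \<subseteq> E \<and> (\<forall>f\<in>faces V E pos curve. \<exists>e\<in>\<Gamma>. guards pos e f)"

end

theory Submission
  imports Defs
begin

text \<open>
  It suffices to colour the vertices with two colours so that every face boundary carries both
  colours and a monochromatic edge.  Take maximal matchings among the monochromatic edges of each
  colour: their union guards all faces, and each of them can also be extended to an edge set
  covering its whole colour class.  These three guard sets have at most \<open>n\<close> edges altogether.

  Such a colouring is a cut \<open>H\<close> of the graph that has exactly two edges on every face.  The dual
  multigraph is 4-regular, so by Petersen's theorem it has a 2-factor \<open>H\<close>; since \<open>H\<close> is even on
  every face boundary it is even on every cycle, hence a cut.  The topological input is that every
  edge on a cycle has two points near its midpoint that are separated by exactly those cycles that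
  pass through the edge; this follows from the Jordan curve theorem and Janiszewski's theorem.
\<close>

subsection \<open>Two-factors of 4-regular multigraphs\<close>

text \<open>The two involutions are perfect matchings on \<open>X\<close>; their union consists of
  cycles that alternate between them and so have even length. Instead of naming these cycles, the
  induction removes the two ends of one \<open>s\<close>-edge at a time.\<close>

lemma two_involutions_coloring:
  fixes s t :: "'a \<Rightarrow> 'a"
  assumes "finite X"
    and "\<And>x. x \<in> X \<Longrightarrow> s x \<in> X \<and> s x \<noteq> x \<and> s (s x) = x"
    and "\<And>x. x \<in> X \<Longrightarrow> t x \<in> X \<and> t x \<noteq> x \<and> t (t x) = x"
  shows "\<exists>c :: 'a \<Rightarrow> bool. \<forall>x\<in>X. c (s x) \<noteq> c x \<and> c (t x) \<noteq> c x"
  using assms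
proof (induction "card X" arbitrary: X t rule: less_induct)
  case less
  note s = less.prems(2) and t = less.prems(3)
  show ?case
  proof (cases "X = {}")
    case False
    then obtain x where x: "x \<in> X" by blast
    define y where "y = s x"
    define X' where "X' = X - {x, y}"
    have y: "y \<in> X" "y \<noteq> x" "s y = x" using s x by (auto simp: y_def)
    have smaller: "card X' < card X" "finite X'"
      using x less.prems(1) unfolding X'_def
      by (auto intro!: psubset_card_mono)
    have s': "s z \<in> X' \<and> s z \<noteq> z \<and> s (s z) = z" if "z \<in> X'" for z
    proof -
      have z: "z \<in> X" "z \<noteq> x" "z \<noteq> y" using that by (auto simp: X'_def)
      then have "s z \<noteq> x" "s z \<noteq> y" using s[OF z(1)] s[OF x] y by (metis y_def)+
      then show ?thesis using s[OF z(1)] by (simp add: X'_def)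
    qed
    show ?thesis
    proof (cases "t x = y")
      case True
      then have ty: "t y = x" using t[OF x] by auto
      have t': "t z \<in> X' \<and> t z \<noteq> z \<and> t (t z) = z" if "z \<in> X'" for z
      proof -
        have z: "z \<in> X" "z \<noteq> x" "z \<noteq> y" using that by (auto simp: X'_def)
        then have "t z \<noteq> x" "t z \<noteq> y" using t[OF z(1)] ty True by metis+
        then show ?thesis using t[OF z(1)] by (simp add: X'_def)
      qed
      have "\<exists>c :: 'a \<Rightarrow> bool. \<forall>z\<in>X'. c (s z) \<noteq> c z \<and> c (t z) \<noteq> c z"
        by (rule less.hyps) (fact smaller s' t')+
      then obtain c :: "'a \<Rightarrow> bool" where c: "\<forall>z\<in>X'. c (s z) \<noteq> c z \<and> c (t z) \<noteq> c z" by blast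
      define c' where "c' = c(x := True, y := False)"
      have "c' (s z) \<noteq> c' z \<and> c' (t z) \<noteq> c' z" if "z \<in> X" for z
      proof (cases "z \<in> X'")
        case True
        then have "z \<notin> {x, y}" "s z \<notin> {x, y}" "t z \<notin> {x, y}"
          using s' t' by (auto simp: X'_def)
        then show ?thesis using bspec[OF c True] by (simp add: c'_def)
      next
        case False
        then have "z = x \<or> z = y" using that by (auto simp: X'_def)
        then show ?thesis using y ty \<open>t x = y\<close> by (auto simp: c'_def y_def[symmetric])
      qed
      then show ?thesis by blast
    next
      case False
      define x' y' where "x' = t x" and "y' = t y"
      have tx: "t x' = x" "x' \<in> X'"
        using t x False by (auto simp: x'_def X'_def)
      have ty: "t y' = y" "y' \<in> X'"
        using t[OF y(1)] False tx t[OF x] by (auto simp: y'_def x'_def X'_def)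
      have neq: "x' \<noteq> y'" using tx ty y by auto
      \<comment> \<open>The path \<open>x'\<close>, \<open>x\<close>, \<open>y\<close>,
        \<open>y'\<close> with edges from \<open>t\<close>, \<open>s\<close>, \<open>t\<close> is
        contracted to a single \<open>t'\<close>-edge. The colouring of the smaller set then
        separates \<open>x'\<close> from \<open>y'\<close>, so giving \<open>x\<close> and
        \<open>y\<close> the opposites of these two colours separates \<open>x\<close> from
        \<open>y\<close> as well.\<close>
      define t' where "t' = t(x' := y', y' := x')"
      have t': "t' z \<in> X' \<and> t' z \<noteq> z \<and> t' (t' z) = z" if "z \<in> X'" for z
      proof (cases "z \<in> {x', y'}")
        case True
        then show ?thesis using tx ty neq by (auto simp: t'_def)
      next
        case False
        have z: "z \<in> X" "z \<noteq> x" "z \<noteq> y" using that by (auto simp: X'_def)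
        have "t z \<notin> {x, y, x', y'}"
          using t[OF z(1)] tx ty z False by (auto simp: x'_def y'_def)
        then show ?thesis using t[OF z(1)] False by (auto simp: t'_def X'_def)
      qed
      have "\<exists>c :: 'a \<Rightarrow> bool. \<forall>z\<in>X'. c (s z) \<noteq> c z \<and> c (t' z) \<noteq> c z"
        by (rule less.hyps) (fact smaller s' t')+
      then obtain c :: "'a \<Rightarrow> bool" where c: "\<forall>z\<in>X'. c (s z) \<noteq> c z \<and> c (t' z) \<noteq> c z" by blast
      have cxy: "c x' \<noteq> c y'" using c tx(2) neq by (auto simp: t'_def split: if_splits)
      define c' where "c' = c(x := (\<not> c x'), y := (\<not> c y'))"
      have "c' (s z) \<noteq> c' z \<and> c' (t z) \<noteq> c' z" if "z \<in> X" for z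
      proof (cases "z \<in> X'")
        case True
        then have z: "z \<notin> {x, y}" "s z \<notin> {x, y}"
          using s' by (auto simp: X'_def)
        consider "z = x'" | "z = y'" | "z \<notin> {x', y'}" by blast
        then have "c' (t z) \<noteq> c' z"
        proof cases
          case 3
          have "t (t z) = z" using t[OF that] by blast
          moreover have "z \<noteq> t x" "z \<noteq> t y"
            using 3 unfolding x'_def[symmetric] y'_def[symmetric] by simp_all
          ultimately have "t z \<noteq> x" "t z \<noteq> y" by metis+
          then show ?thesis using 3 bspec[OF c True] z by (simp add: c'_def t'_def)
        next
          case 1
          then show ?thesis using tx z by (simp add: c'_def y(2)[symmetric])
        next
          case 2
          then show ?thesis using ty z by (simp add: c'_def)
        qed
        moreover have "c' (s z) \<noteq> c' z" using z bspec[OF c True] by (simp add: c'_def)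
        ultimately show ?thesis by blast
      next
        case False
        then have "z = x \<or> z = y" using that by (auto simp: X'_def)
        then show ?thesis using y tx ty cxy
          by (auto simp: c'_def y_def[symmetric] x'_def[symmetric] y'_def[symmetric] X'_def)
      qed
      then show ?thesis by blast
    qed
  qed auto
qed

definition other :: "'a set \<Rightarrow> 'a \<Rightarrow> 'a" where
  "other S x = (THE y. y \<in> S \<and> y \<noteq> x)"

lemma other_involution:
  assumes "card S = 2" "x \<in> S"
  shows "other S x \<in> S" "other S x \<noteq> x" "other S (other S x) = x" "S = {x, other S x}"
proof -
  obtain y where y: "S = {x, y}" "y \<noteq> x"
    using assms by (auto simp: card_2_iff doubleton_eq_iff)
  then have "other S x = y" "other S y = x"
    by (auto simp: other_def)
  then show "other S x \<in> S" "other S x \<noteq> x" "other S (other S x) = x" "S = {x, other S x}"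
    using y by auto
qed

text \<open>Serves to pair up the four edges at a vertex arbitrarily; following such pairings traces
  closed trails, which replace an Euler tour.\<close>

lemma card_4_involution:
  assumes "card S = 4"
  shows "\<exists>t. \<forall>x\<in>S. t x \<in> S \<and> t x \<noteq> x \<and> t (t x) = x"
proof -
  obtain T where T: "T \<subseteq> S" "card T = 2"
    using assms obtain_subset_with_card_n[of 2 S] by auto
  then have T': "card (S - T) = 2"
    using assms by (simp add: card_Diff_subset finite_subset card_ge_0_finite)
  define t where "t x = (if x \<in> T then other T x else other (S - T) x)" for x
  have "t x \<in> S \<and> t x \<noteq> x \<and> t (t x) = x" if "x \<in> S" for x
  proof (cases "x \<in> T")
    case True
    then show ?thesis using other_involution[OF T(2) True] T(1) by (auto simp: t_def)
  next
    case False
    then show ?thesis using other_involution[OF T', of x] that by (auto simp: t_def)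
  qed
  then show ?thesis by blast
qed

lemma involution_card_halves:
  assumes "finite S" and t: "\<And>x. x \<in> S \<Longrightarrow> t x \<in> S \<and> t (t x) = x \<and> c (t x) \<noteq> (c x :: bool)"
  shows "2 * card {x \<in> S. c x = b} = card S"
proof -
  have "bij_betw t {x \<in> S. c x = b} {x \<in> S. c x \<noteq> b}"
    by (rule bij_betw_byWitness[where f' = t]) (use t in auto)
  then have "card {x \<in> S. c x = b} = card {x \<in> S. c x \<noteq> b}"
    by (rule bij_betw_same_card)
  moreover have "card S = card {x \<in> S. c x = b} + card {x \<in> S. c x \<noteq> b}"
    using assms(1) by (subst card_Un_disjoint[symmetric]) (auto intro!: arg_cong[where f = card])
  ultimately show ?thesis by simp
qed

text \<open>Petersen's theorem for loopless multigraphs: \<open>F\<close> is the set of vertices and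
  \<open>B f\<close> the set of edges at \<open>f\<close>. A first use of
  \<open>two_involutions_coloring\<close> orients the edges so that all in- and outdegrees are 2.
  Splitting each vertex into an out-copy and an in-copy gives a bipartite 2-regular graph, and a
  second use selects alternate edges of it.\<close>

lemma four_regular_two_factor:
  fixes F :: "'f set" and B :: "'f \<Rightarrow> 'e set"
  assumes "finite F"
    and four: "\<And>f. f \<in> F \<Longrightarrow> card (B f) = 4"
    and two: "\<And>f e. f \<in> F \<Longrightarrow> e \<in> B f \<Longrightarrow> card {g \<in> F. e \<in> B g} = 2"
  obtains H where "\<And>f. f \<in> F \<Longrightarrow> card (B f \<inter> H) = 2"
proof -
  have finB: "finite (B f)" if "f \<in> F" for f
    using four[OF that] by (simp add: card_ge_0_finite)
  define inc where "inc e = {g \<in> F. e \<in> B g}" for e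
  have inc: "card (inc e) = 2" "f \<in> inc e" if "f \<in> F" "e \<in> B f" for f e
    using two that by (auto simp: inc_def)
  have "\<forall>f\<in>F. \<exists>t. \<forall>x\<in>B f. t x \<in> B f \<and> t x \<noteq> x \<and> t (t x) = x"
    using card_4_involution[OF four] by blast
  then obtain \<tau> where \<tau>: "\<And>f e. f \<in> F \<Longrightarrow> e \<in> B f \<Longrightarrow> \<tau> f e \<in> B f \<and> \<tau> f e \<noteq> e \<and> \<tau> f (\<tau> f e) = e"
    by metis
  \<comment> \<open>These are the half-edges. One involution passes to the other end of the same
    edge, the other to the partner edge at the same vertex. A colouring that changes under both is a
    balanced orientation.\<close>
  define X where "X = Sigma F B"
  have "\<exists>c :: 'f \<times> 'e \<Rightarrow> bool. \<forall>x\<in>X.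
      c ((\<lambda>(f, e). (other (inc e) f, e)) x) \<noteq> c x \<and> c ((\<lambda>(f, e). (f, \<tau> f e)) x) \<noteq> c x"
  proof (rule two_involutions_coloring)
    show "finite X" using assms(1) finB by (auto simp: X_def)
  next
    fix x assume "x \<in> X"
    then obtain f e where x: "x = (f, e)" "f \<in> F" "e \<in> B f" by (auto simp: X_def)
    have "other (inc e) f \<in> inc e" "other (inc e) f \<noteq> f" "other (inc e) (other (inc e) f) = f"
      using other_involution[OF inc[OF x(2,3)]] by auto
    then show "(\<lambda>(f, e). (other (inc e) f, e)) x \<in> X \<and> (\<lambda>(f, e). (other (inc e) f, e)) x \<noteq> x \<and>
        (\<lambda>(f, e). (other (inc e) f, e)) ((\<lambda>(f, e). (other (inc e) f, e)) x) = x"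
      by (auto simp: x X_def inc_def)
    show "(\<lambda>(f, e). (f, \<tau> f e)) x \<in> X \<and> (\<lambda>(f, e). (f, \<tau> f e)) x \<noteq> x \<and>
        (\<lambda>(f, e). (f, \<tau> f e)) ((\<lambda>(f, e). (f, \<tau> f e)) x) = x"
      using \<tau>[OF x(2,3)] x by (auto simp: X_def)
  qed
  then obtain c :: "'f \<times> 'e \<Rightarrow> bool" where c0: "\<forall>x\<in>X.
      c ((\<lambda>(f, e). (other (inc e) f, e)) x) \<noteq> c x \<and> c ((\<lambda>(f, e). (f, \<tau> f e)) x) \<noteq> c x"
    by blast
  have c: "c (other (inc e) f, e) \<noteq> c (f, e) \<and> c (f, \<tau> f e) \<noteq> c (f, e)"
    if "f \<in> F" "e \<in> B f" for f e
    using bspec[OF c0, of "(f, e)"] that by (simp add: X_def)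
  \<comment> \<open>With \<open>True\<close> read as outgoing, \<open>P True f\<close> holds the two
    edges leaving \<open>f\<close> and \<open>P False f\<close> the two entering it. Every edge has
    one tail and one head, so for fixed \<open>b\<close> these classes partition the edges.\<close>
  define P where "P b f = {e \<in> B f. c (f, e) = b}" for b f
  have P: "card (P b f) = 2" if "f \<in> F" for b f
    using involution_card_halves[of "B f" "\<tau> f" "\<lambda>e. c (f, e)" b] that \<tau> c finB four
    by (simp add: P_def)
  define E where "E = \<Union> (B ` F)"
  have ex1: "\<exists>!f. f \<in> F \<and> e \<in> P b f" if e: "e \<in> E" for b e
  proof -
    obtain f where f: "f \<in> F" "e \<in> B f" using e by (auto simp: E_def)
    define g where "g = other (inc e) f"
    have "inc e = {f, g}" and neq: "c (g, e) \<noteq> c (f, e)"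
      using other_involution[OF inc[OF f]] c[OF f] by (auto simp: g_def)
    then have at: "h \<in> F \<and> e \<in> B h \<longleftrightarrow> h = f \<or> h = g" for h
      by (auto simp: inc_def)
    have "h \<in> F \<and> e \<in> P b h \<longleftrightarrow> h = (if c (f, e) = b then f else g)" for h
      using at[of h] neq by (auto simp: P_def)
    then show ?thesis by simp
  qed
  define h where "h b e = (THE f. f \<in> F \<and> e \<in> P b f)" for b e
  have h: "h b e \<in> F" "e \<in> P b (h b e)" if "e \<in> E" for b e
    using theI'[OF ex1[OF that]] by (auto simp: h_def)
  have h_eq: "h b e = f" if "f \<in> F" "e \<in> P b f" for b e f
  proof -
    have "e \<in> E" using that by (auto simp: E_def P_def)
    then show ?thesis using ex1 h that by blast
  qed
  \<comment> \<open>The other edge with the same tail for \<open>True\<close>, with the same head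
    for \<open>False\<close>. A colouring \<open>k\<close> that changes under both selects one edge
    of each class, hence two edges at each vertex.\<close>
  define \<alpha> where "\<alpha> b e = other (P b (h b e)) e" for b e
  have \<alpha>: "\<alpha> b e \<in> E \<and> \<alpha> b e \<noteq> e \<and> \<alpha> b (\<alpha> b e) = e" if "e \<in> E" for b e
  proof -
    note o = other_involution[OF P[OF h(1)[OF that]] h(2)[OF that]]
    have "h b (\<alpha> b e) = h b e"
      using h_eq[OF h(1)[OF that]] o(1) by (simp add: \<alpha>_def)
    moreover have "\<alpha> b e \<in> E"
      using o(1)[of b] h(1)[OF that, of b] by (auto simp: \<alpha>_def E_def P_def)
    ultimately show ?thesis
      using o(2,3)[of b] by (simp add: \<alpha>_def)
  qed
  have "finite E" using assms(1) finB by (auto simp: E_def)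
  then obtain k :: "'e \<Rightarrow> bool" where k: "\<And>e b. e \<in> E \<Longrightarrow> k (\<alpha> b e) \<noteq> k e"
    using two_involutions_coloring[of E "\<alpha> True" "\<alpha> False"] \<alpha> by (metis (full_types))
  have half: "card {e \<in> P b f. k e = True} = 1" if f: "f \<in> F" for b f
  proof -
    have "2 * card {e \<in> P b f. k e = True} = card (P b f)"
    proof (rule involution_card_halves)
      show "finite (P b f)" using P[OF f] by (simp add: card_ge_0_finite)
    next
      fix e assume e: "e \<in> P b f"
      then have E: "e \<in> E" using f by (auto simp: E_def P_def)
      have "\<alpha> b e \<in> P b f"
        using other_involution(1)[OF P[OF f] e] h_eq[OF f e] by (simp add: \<alpha>_def)
      then show "\<alpha> b e \<in> P b f \<and> \<alpha> b (\<alpha> b e) = e \<and> k (\<alpha> b e) \<noteq> k e"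
        using \<alpha>[OF E] k[OF E] by auto
    qed
    then show ?thesis using P[OF f] by simp
  qed
  have "card (B f \<inter> Collect k) = 2" if f: "f \<in> F" for f
  proof -
    have "B f \<inter> Collect k = {e \<in> P True f. k e = True} \<union> {e \<in> P False f. k e = True}"
      by (auto simp: P_def)
    moreover have "card \<dots> = 1 + 1"
      by (subst card_Un_disjoint) (use half[OF f, of True] half[OF f, of False] finB[OF f] in \<open>auto simp: P_def\<close>)
    ultimately show ?thesis by simp
  qed
  then show ?thesis by (rule that)
qed

subsection \<open>Cycles and cuts\<close>

fun path_edges :: "'a list \<Rightarrow> 'a set set" where
  "path_edges (x # y # xs) = insert {x, y} (path_edges (y # xs))"
| "path_edges _ = {}"

definition cycle_edges :: "'a list \<Rightarrow> 'a set set" where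
  "cycle_edges xs = insert {last xs, hd xs} (path_edges xs)"

definition is_cycle :: "'a set set \<Rightarrow> 'a list \<Rightarrow> bool" where
  "is_cycle E xs \<longleftrightarrow> distinct xs \<and> 3 \<le> length xs \<and> cycle_edges xs \<subseteq> E"

lemma path_edges_append:
  "xs \<noteq> [] \<Longrightarrow> ys \<noteq> [] \<Longrightarrow>
    path_edges (xs @ ys) = path_edges xs \<union> insert {last xs, hd ys} (path_edges ys)"
  by (induction xs rule: path_edges.induct) (auto simp: neq_Nil_conv)

lemma path_edges_Cons:
  "path_edges (x # xs) = (if xs = [] then {} else insert {x, hd xs} (path_edges xs))"
  by (cases xs) auto

lemma finite_path_edges: "finite (path_edges xs)"
  by (induction xs rule: path_edges.induct) auto

lemma path_edges_subset: "e \<in> path_edges xs \<Longrightarrow> e \<subseteq> set xs"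
  by (induction xs rule: path_edges.induct) auto

lemma path_edges_nth:
  "e \<in> path_edges xs \<Longrightarrow> \<exists>us x y ws. xs = us @ x # y # ws \<and> e = {x, y}"
proof (induction xs rule: path_edges.induct)
  case (1 x y xs)
  show ?case
  proof (cases "e = {x, y}")
    case True
    then show ?thesis by (metis append_Nil)
  next
    case False
    then have "e \<in> path_edges (y # xs)" using 1 by auto
    then show ?thesis using "1.IH" by (metis append_Cons)
  qed
qed auto

lemma cycle_edges_rotate:
  "xs \<noteq> [] \<Longrightarrow> ys \<noteq> [] \<Longrightarrow> cycle_edges (xs @ ys) = cycle_edges (ys @ xs)"
  by (auto simp: cycle_edges_def path_edges_append)

text \<open>On two vertices the closing edge would be the path edge itself; from three vertices on,
  the first and the last are not consecutive.\<close>

lemma closing_edge_notin_path: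
  assumes "distinct xs" "3 \<le> length xs"
  shows "{last xs, hd xs} \<notin> path_edges xs"
proof
  assume "{last xs, hd xs} \<in> path_edges xs"
  then obtain us x y ws where xs: "xs = us @ x # y # ws" "{last xs, hd xs} = {x, y}"
    using path_edges_nth by blast
  show False
  proof (cases "us = []")
    case True
    then have "ws \<noteq> []" using assms xs by auto
    then have "last xs \<in> set ws" using xs by auto
    then show False using assms xs True by (auto simp: doubleton_eq_iff)
  next
    case False
    then have "hd xs \<in> set us" using xs by auto
    then show False using assms xs False by (auto simp: doubleton_eq_iff)
  qed
qed

text \<open>Makes a chosen edge the closing one, so that deleting it from the cycle leaves the path
  \<open>ys\<close>.\<close>

lemma is_cycle_rotate_to:
  assumes "is_cycle E xs" "e \<in> cycle_edges xs"
  obtains ys where "is_cycle E ys" "cycle_edges ys = cycle_edges xs" "e = {last ys, hd ys}"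
proof (cases "e \<in> path_edges xs")
  case True
  then obtain us x y ws where xs: "xs = us @ x # y # ws" "e = {x, y}"
    using path_edges_nth by blast
  have "cycle_edges ((us @ [x]) @ (y # ws)) = cycle_edges ((y # ws) @ (us @ [x]))"
    by (rule cycle_edges_rotate) auto
  then show ?thesis
    using that[of "(y # ws) @ (us @ [x])"] assms(1) xs by (auto simp: is_cycle_def)
next
  case False
  then show ?thesis using that[of xs] assms by (auto simp: cycle_edges_def)
qed

text \<open>Walking along the path, the colour changes exactly at the edges of
  \<open>H\<close>.\<close>

lemma path_parity:
  fixes c :: "'a \<Rightarrow> bool"
  assumes "distinct xs" "xs \<noteq> []"
    and "\<And>x y. {x, y} \<in> path_edges xs \<Longrightarrow> {x, y} \<in> H \<longleftrightarrow> c x \<noteq> c y"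
  shows "even (card (H \<inter> path_edges xs)) \<longleftrightarrow> c (hd xs) = c (last xs)"
  using assms
proof (induction xs rule: path_edges.induct)
  case (1 x y xs)
  have IH: "even (card (H \<inter> path_edges (y # xs))) \<longleftrightarrow> c y = c (last (y # xs))"
    using "1.IH" "1.prems" by auto
  have notin: "{x, y} \<notin> path_edges (y # xs)"
    using path_edges_subset[of "{x, y}" "y # xs"] "1.prems"(1) by auto
  have H: "{x, y} \<in> H \<longleftrightarrow> c x \<noteq> c y" using "1.prems"(3) by simp
  have "card (H \<inter> path_edges (x # y # xs)) =
      card (H \<inter> path_edges (y # xs)) + (if {x, y} \<in> H then 1 else 0)"
    using notin by (auto simp: Int_insert_right finite_path_edges)
  then show ?case using IH H by auto
qed auto

text \<open>Edges are added one by one. An edge \<open>e\<close> joining two components is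
  accommodated by recolouring one of them. An edge inside a component closes a path to a cycle, and
  evenness of that cycle together with \<open>path_parity\<close> shows that the old colouring is
  already right on \<open>e\<close>.\<close>

lemma even_cycles_imp_cut:
  assumes "finite E" "\<And>e. e \<in> E \<Longrightarrow> card e = 2"
    and "\<And>xs. is_cycle E xs \<Longrightarrow> even (card (H \<inter> cycle_edges xs))"
  shows "\<exists>c :: 'a \<Rightarrow> bool. \<forall>x y. {x, y} \<in> E \<longrightarrow> ({x, y} \<in> H \<longleftrightarrow> c x \<noteq> c y)"
  using assms
proof (induction E rule: finite_induct)
  case (insert e E)
  have "\<exists>c :: 'a \<Rightarrow> bool. \<forall>x y. {x, y} \<in> E \<longrightarrow> ({x, y} \<in> H \<longleftrightarrow> c x \<noteq> c y)"
    using insert.IH insert.prems by (simp add: is_cycle_def subset_insertI2)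
  then obtain c :: "'a \<Rightarrow> bool" where c: "\<And>x y. {x, y} \<in> E \<Longrightarrow> {x, y} \<in> H \<longleftrightarrow> c x \<noteq> c y" by blast
  obtain u v where e: "e = {u, v}" "u \<noteq> v" using insert.prems(1)[of e] by (auto simp: card_2_iff)
  define K where "K = {w. \<exists>p. p \<noteq> [] \<and> distinct p \<and> hd p = u \<and> last p = w \<and> path_edges p \<subseteq> E}"
  have uK: "u \<in> K" by (auto simp: K_def intro!: exI[of _ "[u]"])
  \<comment> \<open>A path to \<open>x\<close> that already visits \<open>y\<close> is cut off at
    \<open>y\<close>, which keeps its vertices distinct; any other path is extended by
    \<open>y\<close>.\<close>
  have closed: "y \<in> K" if xy: "{x, y} \<in> E" "x \<in> K" for x y
  proof -
    obtain p where p: "p \<noteq> []" "distinct p" "hd p = u" "last p = x" "path_edges p \<subseteq> E"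
      using xy by (auto simp: K_def)
    show ?thesis
    proof (cases "y \<in> set p")
      case True
      then obtain us ws where "p = us @ y # ws" by (meson split_list)
      then show ?thesis
        using p unfolding K_def
        by (cases "us = []")
          (auto simp: path_edges_append path_edges_Cons hd_append intro!: exI[of _ "us @ [y]"])
    next
      case False
      then show ?thesis using p xy unfolding K_def
        by (auto simp: path_edges_append intro!: exI[of _ "p @ [y]"])
    qed
  qed
  show ?case
  proof (cases "v \<in> K")
    case False
    \<comment> \<open>Flips the colours on the component \<open>K\<close> of \<open>u\<close>
      exactly when \<open>c\<close> is wrong on \<open>e\<close>, that is, when
      \<open>c u = c v\<close> agrees with \<open>e \<in> H\<close>.\<close>
    define c' where "c' x = (if x \<in> K then (c x \<noteq> ((c u = c v) = (e \<in> H))) else c x)" for x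
    have "({x, y} \<in> H) \<longleftrightarrow> c' x \<noteq> c' y" if xy: "{x, y} \<in> insert e E" for x y
    proof (cases "{x, y} \<in> E")
      case True
      then have "x \<in> K \<longleftrightarrow> y \<in> K" using closed[of x y] closed[of y x] by (auto simp: insert_commute)
      then show ?thesis using c[OF True] by (auto simp: c'_def)
    next
      case F: False
      then have "{x, y} = {u, v}" using xy e by auto
      then show ?thesis using uK False e by (auto simp: c'_def doubleton_eq_iff insert_commute)
    qed
    then show ?thesis by blast
  next
    case True
    then obtain p where p: "p \<noteq> []" "distinct p" "hd p = u" "last p = v" "path_edges p \<subseteq> E"
      by (auto simp: K_def)
    have notin: "{v, u} \<notin> path_edges p" using p insert.hyps e by (auto simp: insert_commute)
    have len: "3 \<le> length p"
    proof (rule ccontr)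
      assume "\<not> 3 \<le> length p"
      then consider a where "p = [a]" | a b where "p = [a, b]"
        using p(1) by (cases p; cases "tl p"; cases "tl (tl p)") auto
      then show False using p e notin by cases (auto simp: insert_commute)
    qed
    have "is_cycle (insert e E) p"
      using p len e by (auto simp: is_cycle_def cycle_edges_def insert_commute)
    then have ev: "even (card (H \<inter> cycle_edges p))" using insert.prems by blast
    have "card (H \<inter> cycle_edges p) = card (H \<inter> path_edges p) + (if e \<in> H then 1 else 0)"
      using notin p e by (auto simp: cycle_edges_def Int_insert_right insert_commute finite_path_edges)
    moreover have "even (card (H \<inter> path_edges p)) \<longleftrightarrow> c u = c v"
      using path_parity[OF p(2,1), of H c] p c by auto
    ultimately have "e \<in> H \<longleftrightarrow> c u \<noteq> c v" using ev by (auto split: if_splits)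
    then show ?thesis using c e by (auto simp: doubleton_eq_iff insert_commute intro!: exI[of _ c])
  qed
qed auto

subsection \<open>Guard sets from guard colourings\<close>

text \<open>\<open>M\<close> is a maximum matching inside \<open>R\<close>, and \<open>N\<close>
  adds to it one edge for each non-isolated vertex of \<open>R\<close> that \<open>M\<close> misses.
  At most \<open>card R - 2 * card M\<close> edges are added, so \<open>card N\<close> is at most
  \<open>card R - card M\<close>.\<close>

lemma matching_and_cover:
  assumes "finite R" "\<And>e. e \<in> E \<Longrightarrow> card e = 2" "finite E"
  obtains M N where "M \<subseteq> E" "N \<subseteq> E" "card M + card N \<le> card R"
    "\<And>x y. {x, y} \<in> E \<Longrightarrow> {x, y} \<subseteq> R \<Longrightarrow> {x, y} \<inter> \<Union> M \<noteq> {}"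
    "R \<inter> \<Union> E \<subseteq> \<Union> N"
proof -
  define matching where "matching M \<longleftrightarrow> M \<subseteq> {e \<in> E. e \<subseteq> R} \<and> disjoint M" for M
  have "\<exists>M. matching M \<and> (\<forall>M'. matching M' \<longrightarrow> card M' \<le> card M)"
  proof (rule ex_has_greatest_nat)
    show "matching {}" by (auto simp: matching_def)
    show "\<forall>M. matching M \<longrightarrow> card M < Suc (card E)"
      using assms(3) by (auto simp: matching_def less_Suc_eq_le intro!: card_mono)
  qed
  then obtain M where M: "matching M" "\<And>M'. matching M' \<Longrightarrow> card M' \<le> card M" by blast
  have ME: "M \<subseteq> E" "disjoint M" "\<Union> M \<subseteq> R" using M(1) by (auto simp: matching_def)
  have finM: "finite M" by (rule finite_subset[OF ME(1) assms(3)])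
  have cardM: "card (\<Union> M) = 2 * card M"
  proof -
    have "finite e" if "e \<in> M" for e
      using ME(1) assms(2)[of e] that by (intro card_ge_0_finite) auto
    then have "card (\<Union> M) = (\<Sum>e\<in>M. card e)"
      using ME(2) by (intro card_Union_disjoint)
    also have "\<dots> = (\<Sum>e\<in>M. 2)" using ME assms(2) by (intro sum.cong) auto
    finally show ?thesis by simp
  qed
  have max: "{x, y} \<inter> \<Union> M \<noteq> {}" if xy: "{x, y} \<in> E" "{x, y} \<subseteq> R" for x y
  proof
    assume disj: "{x, y} \<inter> \<Union> M = {}"
    then have "{x, y} \<notin> M" by auto
    moreover have "matching (insert {x, y} M)"
      using M(1) xy disj by (auto simp: matching_def pairwise_insert disjnt_def)
    ultimately show False using M(2)[of "insert {x, y} M"] finM by simp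
  qed
  \<comment> \<open>An arbitrary edge at \<open>x\<close>; its other end may lie outside
    \<open>R\<close>.\<close>
  define g where "g x = (SOME e. e \<in> E \<and> x \<in> e)" for x
  have g: "g x \<in> E" "x \<in> g x" if "x \<in> \<Union> E" for x
    using that someI_ex[of "\<lambda>e. e \<in> E \<and> x \<in> e"] by (auto simp: g_def)
  define U where "U = R \<inter> \<Union> E - \<Union> M"
  have "card M + card (M \<union> g ` U) \<le> card R"
  proof -
    have "card (M \<union> g ` U) \<le> card M + card U"
      using card_Un_le[of M "g ` U"] card_image_le[of U g] assms(1) by (simp add: U_def)
    moreover have "card U \<le> card (R - \<Union> M)"
      using assms(1) by (intro card_mono) (auto simp: U_def)
    moreover have "card (R - \<Union> M) = card R - card (\<Union> M)"
      using ME assms(1) by (intro card_Diff_subset) (auto intro: finite_subset)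
    moreover have "card (\<Union> M) \<le> card R" using ME assms(1) by (intro card_mono) auto
    ultimately show ?thesis using cardM by simp
  qed
  moreover have "M \<union> g ` U \<subseteq> E" using ME(1) g(1) by (auto simp: U_def simp del: Union_iff)
  moreover have "R \<inter> \<Union> E \<subseteq> \<Union> (M \<union> g ` U)"
  proof
    fix x assume "x \<in> R \<inter> \<Union> E"
    then show "x \<in> \<Union> (M \<union> g ` U)" using g(2)[of x] by (cases "x \<in> \<Union> M") (auto simp: U_def)
  qed
  ultimately show ?thesis using that[of M "M \<union> g ` U"] ME max by blast
qed

text \<open>The candidates are \<open>M True \<union> M False\<close>, which meets every
  monochromatic edge, and \<open>N True\<close> and \<open>N False\<close>, each of which covers the
  non-isolated vertices of its colour. Their sizes add up to at most \<open>card V\<close>, so one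
  of them has at most a third of it.\<close>

lemma guard_coloring_imp_guards:
  fixes c :: "'a \<Rightarrow> bool"
  assumes "finite V" and E: "\<And>e. e \<in> E \<Longrightarrow> e \<subseteq> V \<and> card e = 2"
    and mono: "\<And>S. S \<in> \<S> \<Longrightarrow> \<exists>x y. {x, y} \<in> E \<and> {x, y} \<subseteq> S \<and> c x = c y"
    and bichrom: "\<And>S b. S \<in> \<S> \<Longrightarrow> \<exists>x\<in>S. x \<in> \<Union> E \<and> c x = b"
  obtains \<Gamma> where "\<Gamma> \<subseteq> E" "3 * card \<Gamma> \<le> card V" "\<And>S. S \<in> \<S> \<Longrightarrow> \<exists>e\<in>\<Gamma>. e \<inter> S \<noteq> {}"
proof -
  have finE: "finite E" using assms(1) E by (auto intro: finite_subset[of E "Pow V"])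
  define good where "good b M N \<longleftrightarrow> M \<subseteq> E \<and> N \<subseteq> E \<and> card M + card N \<le> card {v \<in> V. c v = b} \<and>
    (\<forall>x y. {x, y} \<in> E \<longrightarrow> {x, y} \<subseteq> {v \<in> V. c v = b} \<longrightarrow> {x, y} \<inter> \<Union> M \<noteq> {}) \<and>
    {v \<in> V. c v = b} \<inter> \<Union> E \<subseteq> \<Union> N" for b M N
  have "\<exists>M N. good b M N" for b
  proof (rule matching_and_cover[of "{v \<in> V. c v = b}" E])
    show "finite {v \<in> V. c v = b}" "finite E" using assms(1) finE by auto
    show "card e = 2" if "e \<in> E" for e using E[OF that] by simp
  next
    fix M N
    assume "M \<subseteq> E" "N \<subseteq> E" "card M + card N \<le> card {v \<in> V. c v = b}"
      "\<And>x y. {x, y} \<in> E \<Longrightarrow> {x, y} \<subseteq> {v \<in> V. c v = b} \<Longrightarrow> {x, y} \<inter> \<Union> M \<noteq> {}"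
      "{v \<in> V. c v = b} \<inter> \<Union> E \<subseteq> \<Union> N"
    then have "good b M N" by (simp add: good_def)
    then show ?thesis by blast
  qed
  then have "\<forall>b. \<exists>M N. good b M N" by blast
  then obtain M N where "\<forall>b. good b (M b) (N b)" unfolding choice_iff by blast
  then have MN: "M b \<subseteq> E" "N b \<subseteq> E" "card (M b) + card (N b) \<le> card {v \<in> V. c v = b}"
    "{x, y} \<in> E \<Longrightarrow> {x, y} \<subseteq> {v \<in> V. c v = b} \<Longrightarrow> {x, y} \<inter> \<Union> (M b) \<noteq> {}"
    "{v \<in> V. c v = b} \<inter> \<Union> E \<subseteq> \<Union> (N b)" for b x y
    by (simp_all add: good_def)
  have N: "\<exists>e\<in>N b. e \<inter> S \<noteq> {}" if S: "S \<in> \<S>" for b S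
  proof -
    obtain x where x: "x \<in> S" "x \<in> \<Union> E" "c x = b" using bichrom[OF S, of b] by (elim bexE conjE)
    then have "x \<in> V" using E by blast
    then have "x \<in> \<Union> (N b)" using subsetD[OF MN(5), of x b] x by simp
    then show ?thesis using x(1) by blast
  qed
  have M: "\<exists>e\<in>M True \<union> M False. e \<inter> S \<noteq> {}" if S: "S \<in> \<S>" for S
  proof -
    obtain x y where xy: "{x, y} \<in> E" "{x, y} \<subseteq> S" "c x = c y" using mono[OF S] by blast
    then have "{x, y} \<inter> \<Union> (M (c x)) \<noteq> {}" using E[of "{x, y}"] by (intro MN(4)) auto
    then show ?thesis using xy by (cases "c x") auto
  qed
  have "card {v \<in> V. c v = True} + card {v \<in> V. c v = False} = card V"
    using assms(1) by (subst card_Un_disjoint[symmetric]) (auto intro!: arg_cong[where f = card])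
  moreover have "card (M True \<union> M False) \<le> card (M True) + card (M False)" by (rule card_Un_le)
  ultimately consider "3 * card (N True) \<le> card V" | "3 * card (N False) \<le> card V"
      | "3 * card (M True \<union> M False) \<le> card V"
    using MN(3)[of True] MN(3)[of False] by linarith
  then show ?thesis
  proof cases
    case 3
    show ?thesis by (rule that[OF _ 3]) (use MN(1) M in simp_all)
  qed (rule that[OF MN(2) _ N]; assumption)+
qed

subsection \<open>Separation in plane graphs\<close>

text \<open>Erasing the part of \<open>D\<close> outside \<open>C\<close> does not enlarge
  \<open>f\<close>: a connected set that leaves \<open>f\<close> meets the frontier of
  \<open>f\<close>, which stays in \<open>C\<close>.\<close>

lemma face_eq_component:
  fixes f :: "'a::topological_space set"
  assumes "f \<in> components (- D)" "frontier f \<subseteq> C" "C \<subseteq> D"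
  shows "f \<in> components (- C)"
proof -
  have f: "f \<noteq> {}" "connected f" "f \<inter> C = {}"
    using assms in_components_nonempty in_components_connected in_components_subset by blast+
  obtain x where x: "x \<in> f" using f by blast
  define K where "K = connected_component_set (- C) x"
  have sub: "f \<subseteq> K"
    unfolding K_def using f x by (intro connected_component_maximal) auto
  have "K - f = {}"
  proof (rule ccontr)
    assume "K - f \<noteq> {}"
    moreover have "K \<inter> f \<noteq> {}" using x sub by blast
    moreover have "connected K" by (simp add: K_def)
    ultimately have "K \<inter> frontier f \<noteq> {}" by (intro connected_Int_frontier)
    moreover have "K \<subseteq> - C" unfolding K_def by (rule connected_component_subset)
    ultimately show False using assms(2) by blast
  qed
  then have "f = K" using sub by blast
  moreover have "x \<in> - C" using f x by blast
  ultimately show ?thesis by (auto simp: components_def K_def)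
qed

lemma connected_component_not_inside:
  "connected_component (- S) a b \<Longrightarrow> a \<in> inside S \<longleftrightarrow> b \<in> inside S"
  by (metis connected_component_sym inside_same_component)

text \<open>Neither does \<open>P \<union> Q\<close> separate \<open>a\<close> from \<open>b\<close>, since it misses the ball.  If \<open>G \<union> Q\<close> did not
  either, Janiszewski's theorem would extend this to the union, which contains \<open>G \<union> P\<close>.\<close>

lemma separation_transfer:
  fixes a b :: complex
  assumes "compact G" "compact P" "compact Q" "connected Q" "G \<inter> P \<subseteq> Q"
    and "ball p r \<inter> (P \<union> Q) = {}" "a \<in> ball p r" "b \<in> ball p r"
    and "\<not> connected_component (- (G \<union> P)) a b"
  shows "\<not> connected_component (- (G \<union> Q)) a b"
proof
  assume "connected_component (- (G \<union> Q)) a b"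
  moreover have "connected_component (- (P \<union> Q)) a b"
    unfolding connected_component_def using assms(6-8)
    by (intro exI[of _ "ball p r"]) auto
  moreover have "(G \<union> Q) \<inter> (P \<union> Q) = Q" using assms(5) by blast
  ultimately have "connected_component (- ((G \<union> Q) \<union> (P \<union> Q))) a b"
    using assms(1-4)
    by (intro Janiszewski[of "G \<union> Q" "P \<union> Q"])
      (simp_all del: Compl_Un compl_sup add: compact_Un compact_imp_closed)
  then have "connected_component (- (G \<union> P)) a b"
    by (rule connected_component_of_subset) auto
  then show False using assms(9) by blast
qed

text \<open>By the Jordan curve theorem inside and outside are both connected, so two points off the
  curve on the same side can be joined.\<close>

lemma Jordan_connected_component_iff:
  fixes c :: "real \<Rightarrow> complex"
  assumes "simple_path c" "pathfinish c = pathstart c" "a \<notin> path_image c" "b \<notin> path_image c"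
  shows "connected_component (- path_image c) a b \<longleftrightarrow>
    (a \<in> inside (path_image c) \<longleftrightarrow> b \<in> inside (path_image c))"
proof
  assume *: "a \<in> inside (path_image c) \<longleftrightarrow> b \<in> inside (path_image c)"
  have conn: "connected (inside (path_image c))" "connected (outside (path_image c))"
    using Jordan_inside_outside[OF assms(1,2)] by auto
  have un: "inside (path_image c) \<union> outside (path_image c) = - path_image c" by simp
  show "connected_component (- path_image c) a b"
  proof (cases "a \<in> inside (path_image c)")
    case True
    then show ?thesis
      using * conn un unfolding connected_component_def by blast
  next
    case False
    then have "a \<in> outside (path_image c)" "b \<in> outside (path_image c)" using * un assms by blast+
    then show ?thesis using conn un unfolding connected_component_def by blast
  qed
qed (rule connected_component_not_inside)

section \<open>Cycles as Jordan curves and the two sides of an edge\<close>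

definition arcs :: "('a set \<Rightarrow> real \<Rightarrow> complex) \<Rightarrow> 'a set set \<Rightarrow> complex set" where
  "arcs curve S = (\<Union>e\<in>S. path_image (curve e))"

context plane_graph
begin

lemma finite_E: "finite E"
  using edges finite_vertices by (auto intro: finite_subset[of E "Pow V"])

lemma pos_in_curve: "e \<in> E \<Longrightarrow> v \<in> e \<Longrightarrow> pos v \<in> path_image (curve e)"
  using curve_ends[of e] pathstart_in_path_image[of "curve e"] pathfinish_in_path_image[of "curve e"]
  by (metis imageI insertE singletonD)

lemma edge_vertices: "{x, y} \<in> E \<Longrightarrow> x \<in> V \<and> y \<in> V \<and> x \<noteq> y"
  using edges[of "{x, y}"] by auto

lemma compact_arcs: "S \<subseteq> E \<Longrightarrow> compact (arcs curve S)"
  using finite_E finite_subset[of S E] curve_arc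
  by (auto simp: arcs_def intro!: compact_UN compact_arc_image)

text \<open>\<open>curve_ends\<close> gives the ends only as an unordered pair, so the arc may have
  to be reversed before it can be concatenated.\<close>

lemma oriented_edge:
  assumes "{x, y} \<in> E"
  obtains \<gamma> where "arc \<gamma>" "path_image \<gamma> = path_image (curve {x, y})"
    "pathstart \<gamma> = pos x" "pathfinish \<gamma> = pos y"
proof -
  have ends: "{pathstart (curve {x, y}), pathfinish (curve {x, y})} = {pos x, pos y}"
    using curve_ends[OF assms] by simp
  show ?thesis
  proof (cases "pathstart (curve {x, y}) = pos x")
    case True
    then have "pathfinish (curve {x, y}) = pos y" using ends by (auto simp: doubleton_eq_iff)
    then show ?thesis using that[of "curve {x, y}"] True curve_arc[OF assms] by simp
  next
    case False
    then have "pathstart (curve {x, y}) = pos y" "pathfinish (curve {x, y}) = pos x"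
      using ends by (auto simp: doubleton_eq_iff)
    then show ?thesis
      using that[of "reversepath (curve {x, y})"] curve_arc[OF assms] by (simp add: arc_reversepath)
  qed
qed

lemma path_edges_arc:
  assumes "2 \<le> length xs" "distinct xs" "path_edges xs \<subseteq> E"
  shows "\<exists>\<gamma>. arc \<gamma> \<and> path_image \<gamma> = arcs curve (path_edges xs)
    \<and> pathstart \<gamma> = pos (hd xs) \<and> pathfinish \<gamma> = pos (last xs)"
  using assms
proof (induction xs rule: path_edges.induct)
  case (1 x y xs)
  have xy: "{x, y} \<in> E" using "1.prems" by simp
  obtain g where g: "arc g" "path_image g = path_image (curve {x, y})"
    "pathstart g = pos x" "pathfinish g = pos y"
    using oriented_edge[OF xy] by blast
  show ?case
  proof (cases "xs = []")
    case True
    then show ?thesis using g by (intro exI[of _ g]) (simp add: arcs_def)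
  next
    case False
    obtain h where h: "arc h" "path_image h = arcs curve (path_edges (y # xs))"
      "pathstart h = pos y" "pathfinish h = pos (last (y # xs))"
      using "1.IH" "1.prems" False by (cases xs) auto
    \<comment> \<open>The first edge can meet the remaining ones only in common vertices, and
      \<open>x\<close> does not occur again on the path.\<close>
    have "path_image g \<inter> path_image h \<subseteq> {pos y}"
    proof
      fix z assume z: "z \<in> path_image g \<inter> path_image h"
      then obtain e where e: "e \<in> path_edges (y # xs)" "z \<in> path_image (curve e)"
        using h(2) by (auto simp: arcs_def)
      have eE: "e \<in> E" "x \<notin> e"
        using e(1) "1.prems" path_edges_subset[OF e(1)] by auto
      then have "z \<in> pos ` ({x, y} \<inter> e)"
        using crossing_free[OF xy eE(1)] z e(2) g(2) by blast
      then show "z \<in> {pos y}" using eE(2) by auto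
    qed
    then have "arc (g +++ h)" using g h by (intro arc_join) auto
    then show ?thesis
      using g h False by (intro exI[of _ "g +++ h"]) (simp add: path_image_join arcs_def)
  qed
qed auto

text \<open>Splits the Jordan curve of a cycle into the arc of \<open>e\<close> and the
  complementary arc \<open>Q\<close>. That \<open>Q\<close> is connected and contains the ends of
  \<open>e\<close> is what \<open>separation_transfer\<close> will need.\<close>

lemma cycle_decompose:
  assumes "is_cycle E xs" "e \<in> cycle_edges xs"
  obtains \<gamma> Q where "simple_path \<gamma>" "pathfinish \<gamma> = pathstart \<gamma>"
    "path_image \<gamma> = arcs curve (cycle_edges xs)"
    "path_image \<gamma> = path_image (curve e) \<union> Q"
    "Q = arcs curve (cycle_edges xs - {e})" "connected Q" "pos ` e \<subseteq> Q"
proof -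
  obtain ys where ys: "is_cycle E ys" "cycle_edges ys = cycle_edges xs" "e = {last ys, hd ys}"
    using is_cycle_rotate_to[OF assms] by blast
  have d: "distinct ys" "3 \<le> length ys" "path_edges ys \<subseteq> E" and eE: "{last ys, hd ys} \<in> E"
    using ys by (auto simp: is_cycle_def cycle_edges_def)
  have rest: "cycle_edges xs - {e} = path_edges ys"
    using closing_edge_notin_path[OF d(1,2)] unfolding ys(2)[symmetric] ys(3)
    unfolding cycle_edges_def by blast
  obtain h where h: "arc h" "path_image h = arcs curve (path_edges ys)"
    "pathstart h = pos (hd ys)" "pathfinish h = pos (last ys)"
    using path_edges_arc[of ys] d by auto
  obtain g where g: "arc g" "path_image g = path_image (curve e)"
    "pathstart g = pos (last ys)" "pathfinish g = pos (hd ys)"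
    using oriented_edge[OF eE] ys(3) by auto
  have "path_image g \<inter> path_image h \<subseteq> {pathstart g, pathstart h}"
  proof
    fix z assume z: "z \<in> path_image g \<inter> path_image h"
    then obtain e' where e': "e' \<in> path_edges ys" "z \<in> path_image (curve e')"
      using h(2) by (auto simp: arcs_def)
    have "e' \<in> E" "e' \<noteq> e" using e'(1) d(3) rest by auto
    then have "z \<in> pos ` (e \<inter> e')"
      using crossing_free[of e e'] z e'(2) g(2) eE ys(3) by blast
    then show "z \<in> {pathstart g, pathstart h}" using g h ys(3) by auto
  qed
  then have "simple_path (g +++ h)" using g h by (intro simple_path_join_loop) auto
  moreover have img: "path_image (g +++ h) = path_image (curve e) \<union> arcs curve (path_edges ys)"
    using g h by (simp add: path_image_join)
  moreover have "path_image (g +++ h) = arcs curve (cycle_edges xs)"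
    unfolding img ys(2)[symmetric] ys(3) by (auto simp: arcs_def cycle_edges_def)
  moreover have "connected (arcs curve (path_edges ys))"
    using h(1,2) connected_arc_image by metis
  moreover have "pos ` e \<subseteq> arcs curve (path_edges ys)"
    using h pathstart_in_path_image[of h] pathfinish_in_path_image[of h] ys(3) by auto
  ultimately show ?thesis using that[of "g +++ h"] g h rest by simp
qed

lemma midpoint_only_on_edge:
  assumes "e \<in> E"
  shows "curve e (1/2) \<in> path_image (curve e)" "curve e (1/2) \<notin> pos ` V"
    "e' \<in> E \<Longrightarrow> curve e (1/2) \<in> path_image (curve e') \<Longrightarrow> e' = e"
proof -
  show on: "curve e (1/2) \<in> path_image (curve e)" by (auto simp: path_image_def)
  have inj: "inj_on (curve e) {0..1}" using curve_arc[OF assms] by (simp add: arc_def)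
  have "curve e (1/2) \<noteq> pathstart (curve e)" "curve e (1/2) \<noteq> pathfinish (curve e)"
    using inj_onD[OF inj, of "1/2" 0] inj_onD[OF inj, of "1/2" 1]
    by (auto simp: pathstart_def pathfinish_def)
  then have notend: "curve e (1/2) \<notin> pos ` e" using curve_ends[OF assms] by blast
  then show "curve e (1/2) \<notin> pos ` V" using vertex_on_curve[OF assms] on by auto
  show "e' = e" if "e' \<in> E" "curve e (1/2) \<in> path_image (curve e')"
    using crossing_free[OF assms that(1)] that on notend by blast
qed

text \<open>The points come from the given cycle \<open>C\<close>, one on each side of it near the
  midpoint of \<open>e\<close>, and they serve all cycles \<open>D\<close> at once. If
  \<open>D\<close> passes through \<open>e\<close>, then \<open>separation_transfer\<close>
  exchanges the rest of \<open>C\<close> for the rest of \<open>D\<close>; otherwise a small disc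
  around the midpoint joins the two points without meeting \<open>D\<close>.\<close>

lemma edge_separates:
  assumes "is_cycle E C" "e \<in> cycle_edges C"
  obtains a b where "a \<notin> drawing V E pos curve" "b \<notin> drawing V E pos curve"
    "\<And>D. is_cycle E D \<Longrightarrow>
      (a \<in> inside (arcs curve (cycle_edges D)) \<longleftrightarrow> b \<notin> inside (arcs curve (cycle_edges D)))
        \<longleftrightarrow> e \<in> cycle_edges D"
proof -
  have e: "e \<in> E" using assms by (auto simp: is_cycle_def)
  define p where "p = curve e (1/2)"
  \<comment> \<open>Everything drawn except the interior of the arc of \<open>e\<close>. It is
    closed and misses the midpoint \<open>p\<close>, hence also a disc around
    \<open>p\<close>.\<close>
  define R where "R = pos ` V \<union> arcs curve (E - {e})"
  have "closed R"
    unfolding R_def using finite_vertices compact_arcs[of "E - {e}"]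
    by (intro closed_Un finite_imp_closed compact_imp_closed) auto
  moreover have "p \<notin> R"
    using midpoint_only_on_edge[OF e] by (auto simp: R_def p_def arcs_def)
  ultimately obtain r where r: "r > 0" "ball p r \<inter> R = {}"
    using open_contains_ball[of "- R"] by (auto simp: open_Compl disjoint_eq_subset_Compl)
  have drawing: "drawing V E pos curve = R \<union> path_image (curve e)"
    using e by (auto simp: drawing_def R_def arcs_def)
  obtain \<gamma> P where C: "simple_path \<gamma>" "pathfinish \<gamma> = pathstart \<gamma>"
    "path_image \<gamma> = arcs curve (cycle_edges C)" "path_image \<gamma> = path_image (curve e) \<union> P"
    "P = arcs curve (cycle_edges C - {e})"
    using cycle_decompose[OF assms] by metis
  \<comment> \<open>Each point of a Jordan curve is on the frontier of both sides, so the disc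
    contains points of both.\<close>
  have "p \<in> frontier (inside (path_image \<gamma>))" "p \<in> frontier (outside (path_image \<gamma>))"
    using Jordan_inside_outside[OF C(1,2)] midpoint_only_on_edge(1)[OF e] C(4) by (auto simp: p_def)
  then have "p \<in> closure (inside (path_image \<gamma>))" "p \<in> closure (outside (path_image \<gamma>))"
    by (auto simp: frontier_def)
  then obtain a b where a: "a \<in> inside (path_image \<gamma>)" "a \<in> ball p r"
    and b: "b \<in> outside (path_image \<gamma>)" "b \<in> ball p r"
    using r(1) unfolding closure_approachable by (metis mem_ball dist_commute)
  have ab: "a \<notin> path_image \<gamma>" "b \<notin> path_image \<gamma>" "b \<notin> inside (path_image \<gamma>)"
    using a b inside_no_overlap[of "path_image \<gamma>"] outside_no_overlap[of "path_image \<gamma>"]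
      inside_Int_outside[of "path_image \<gamma>"] by blast+
  have off: "a \<notin> drawing V E pos curve" "b \<notin> drawing V E pos curve"
    using a b ab r(2) C(4) drawing by blast+
  have sep: "\<not> connected_component (- (path_image (curve e) \<union> P)) a b"
    using Jordan_connected_component_iff[OF C(1,2) ab(1,2)] a(1) ab(3) C(4) by simp
  have "(a \<in> inside (arcs curve (cycle_edges D)) \<longleftrightarrow> b \<notin> inside (arcs curve (cycle_edges D)))
      \<longleftrightarrow> e \<in> cycle_edges D" if D: "is_cycle E D" for D
  proof (cases "e \<in> cycle_edges D")
    case True
    obtain \<delta> Q where Q: "simple_path \<delta>" "pathfinish \<delta> = pathstart \<delta>"
      "path_image \<delta> = arcs curve (cycle_edges D)" "path_image \<delta> = path_image (curve e) \<union> Q"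
      "Q = arcs curve (cycle_edges D - {e})" "connected Q" "pos ` e \<subseteq> Q"
      using cycle_decompose[OF D True] by metis
    have CE: "cycle_edges C - {e} \<subseteq> E - {e}" and DE: "cycle_edges D - {e} \<subseteq> E - {e}"
      using assms(1) D by (auto simp: is_cycle_def)
    \<comment> \<open>The arc of \<open>e\<close> meets the rest of \<open>C\<close> only in ends of
      \<open>e\<close>, and these lie on the rest of \<open>D\<close> too.\<close>
    have "path_image (curve e) \<inter> P \<subseteq> Q"
    proof
      fix z assume z: "z \<in> path_image (curve e) \<inter> P"
      then obtain e' where e': "e' \<in> cycle_edges C - {e}" "z \<in> path_image (curve e')"
        using C(5) by (auto simp: arcs_def)
      then have "z \<in> pos ` (e \<inter> e')"
        using crossing_free[OF e, of e'] CE z by blast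
      then show "z \<in> Q" using Q(7) by blast
    qed
    moreover have "P \<union> Q \<subseteq> R" using CE DE C(5) Q(5) by (auto simp: R_def arcs_def)
    moreover have "compact P" "compact Q" "compact (path_image (curve e))"
      using CE DE C(5) Q(5) curve_arc[OF e] by (auto intro!: compact_arcs compact_arc_image)
    ultimately have "\<not> connected_component (- (path_image (curve e) \<union> Q)) a b"
      using separation_transfer[OF _ _ _ Q(6) _ _ a(2) b(2) sep] r(2) by blast
    moreover have "a \<notin> path_image \<delta>" "b \<notin> path_image \<delta>"
      using off D Q(3) by (auto simp: is_cycle_def drawing_def arcs_def)
    ultimately have "\<not> (a \<in> inside (path_image \<delta>) \<longleftrightarrow> b \<in> inside (path_image \<delta>))"
      using Jordan_connected_component_iff[OF Q(1,2)] Q(4) by simp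
    then show ?thesis using True Q(3) by auto
  next
    case False
    then have "arcs curve (cycle_edges D) \<subseteq> R"
      using D by (auto simp: is_cycle_def R_def arcs_def)
    then have "connected_component (- arcs curve (cycle_edges D)) a b"
      unfolding connected_component_def using r(2) a(2) b(2)
      by (intro exI[of _ "ball p r"]) auto
    from connected_component_not_inside[OF this] show ?thesis using False by simp
  qed
  with off show ?thesis by (rule that)
qed

end

subsection \<open>Faces of quadrangulations\<close>

context quadrangulation
begin

abbreviation F :: "complex set set" where
  "F \<equiv> faces V E pos curve"

lemma face_cycle:
  assumes "f \<in> F"
  obtains a b c d where "distinct [a, b, c, d]" "is_cycle E [a, b, c, d]" "{a, b, c, d} \<subseteq> V"
    "frontier f = arcs curve (cycle_edges [a, b, c, d])"
proof -
  obtain a b c d where *: "distinct [a, b, c, d]" "{{a, b}, {b, c}, {c, d}, {d, a}} \<subseteq> E"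
    "frontier f = (\<Union>e\<in>{{a, b}, {b, c}, {c, d}, {d, a}}. path_image (curve e))"
    using face_4_cycle[OF assms] unfolding bounded_by_4_cycle_def by metis
  have eq: "cycle_edges [a, b, c, d] = {{a, b}, {b, c}, {c, d}, {d, a}}"
    by (auto simp: cycle_edges_def)
  show ?thesis
  proof (rule that[OF *(1)])
    show "is_cycle E [a, b, c, d]"
      unfolding is_cycle_def eq using *(1,2) by simp
    show "{a, b, c, d} \<subseteq> V"
      using *(2) edge_vertices[of a b] edge_vertices[of c d] by blast
    show "frontier f = arcs curve (cycle_edges [a, b, c, d])"
      unfolding eq arcs_def by (rule *(3))
  qed
qed

text \<open>Fixes one vertex list per face, so that the edges of a face form a definite set.\<close>

definition boundary :: "complex set \<Rightarrow> 'a list" where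
  "boundary f = (SOME xs. length xs = 4 \<and> is_cycle E xs \<and> set xs \<subseteq> V \<and>
    frontier f = arcs curve (cycle_edges xs))"

lemma boundary:
  assumes "f \<in> F"
  shows "length (boundary f) = 4" "is_cycle E (boundary f)" "set (boundary f) \<subseteq> V"
    "frontier f = arcs curve (cycle_edges (boundary f))"
proof -
  have "\<exists>xs. length xs = 4 \<and> is_cycle E xs \<and> set xs \<subseteq> V \<and> frontier f = arcs curve (cycle_edges xs)"
    by (rule face_cycle[OF assms], rule_tac x = "[a, b, c, d]" in exI) simp
  from someI_ex[OF this, folded boundary_def]
  show "length (boundary f) = 4" "is_cycle E (boundary f)" "set (boundary f) \<subseteq> V"
    "frontier f = arcs curve (cycle_edges (boundary f))" by auto
qed

lemma boundary_list:
  assumes "f \<in> F"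
  obtains a b c d where "boundary f = [a, b, c, d]" "distinct [a, b, c, d]"
    "cycle_edges (boundary f) = {{a, b}, {b, c}, {c, d}, {d, a}}"
proof -
  obtain a b c d where abcd: "boundary f = [a, b, c, d]"
    using boundary(1)[OF assms] by (auto simp: numeral_eq_Suc length_Suc_conv)
  moreover have "distinct [a, b, c, d]"
    using boundary(2)[OF assms] unfolding abcd is_cycle_def by blast
  moreover have "cycle_edges (boundary f) = {{a, b}, {b, c}, {c, d}, {d, a}}"
    unfolding abcd by (auto simp: cycle_edges_def)
  ultimately show ?thesis by (rule that)
qed

lemma arcs_subset_drawing: "is_cycle E C \<Longrightarrow> arcs curve (cycle_edges C) \<subseteq> drawing V E pos curve"
  by (auto simp: is_cycle_def arcs_def drawing_def)

lemma cycle_simple_path: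
  assumes "is_cycle E C"
  obtains \<gamma> where "simple_path \<gamma>" "pathfinish \<gamma> = pathstart \<gamma>"
    "path_image \<gamma> = arcs curve (cycle_edges C)"
  using cycle_decompose[OF assms, of "{last C, hd C}"] by (metis cycle_edges_def insertI1)

text \<open>By \<open>face_eq_component\<close> the face is a whole component of the complement of
  its own boundary cycle, and a Jordan curve leaves only two.\<close>

lemma face_inside_or_outside:
  assumes f: "f \<in> F"
  defines "A \<equiv> arcs curve (cycle_edges (boundary f))"
  shows "f = inside A \<or> f = outside A"
proof -
  have comp: "f \<in> components (- A)"
    using face_eq_component[of f "drawing V E pos curve" A] f boundary(4)[OF f]
      arcs_subset_drawing[OF boundary(2)[OF f]]
    by (simp add: faces_def A_def)
  then obtain x where x: "x \<notin> A" "f = connected_component_set (- A) x"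
    by (auto simp: components_def)
  obtain \<gamma> where \<gamma>: "simple_path \<gamma>" "pathfinish \<gamma> = pathstart \<gamma>" "path_image \<gamma> = A"
    using cycle_simple_path[OF boundary(2)[OF f]] unfolding A_def by blast
  have "y \<in> f \<longleftrightarrow> y \<notin> A \<and> (x \<in> inside A \<longleftrightarrow> y \<in> inside A)" for y
    using Jordan_connected_component_iff[OF \<gamma>(1,2), of x y] \<gamma>(3) x
      connected_component_in[of "- A" x y] by auto
  moreover have "y \<in> outside A \<longleftrightarrow> y \<notin> A \<and> y \<notin> inside A" for y
    using inside_Un_outside[of A] inside_Int_outside[of A] by blast
  moreover have "y \<in> inside A \<Longrightarrow> y \<notin> A" for y
    using inside_no_overlap[of A] by blast
  ultimately show ?thesis by blast
qed

text \<open>A face is determined by its boundary list and the side it occupies, and there are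
  finitely many lists of four vertices.\<close>

lemma finite_faces: "finite F"
proof (rule finite_subset)
  let ?L = "{xs. set xs \<subseteq> V \<and> length xs = 4}"
  let ?A = "\<lambda>xs. arcs curve (cycle_edges xs)"
  show "F \<subseteq> (inside \<circ> ?A) ` ?L \<union> (outside \<circ> ?A) ` ?L"
  proof
    fix f assume f: "f \<in> F"
    then have "boundary f \<in> ?L" using boundary by simp
    then show "f \<in> (inside \<circ> ?A) ` ?L \<union> (outside \<circ> ?A) ` ?L"
      using face_inside_or_outside[OF f] by (auto simp del: mem_Collect_eq)
  qed
  show "finite ((inside \<circ> ?A) ` ?L \<union> (outside \<circ> ?A) ` ?L)"
    using finite_lists_length_eq[OF finite_vertices, of 4] by simp
qed

lemma face_subset_inside_iff:
  assumes "f \<in> F" "is_cycle E D" "x \<in> f"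
  shows "f \<subseteq> inside (arcs curve (cycle_edges D)) \<longleftrightarrow> x \<in> inside (arcs curve (cycle_edges D))"
proof -
  have f: "connected f" "f \<subseteq> - arcs curve (cycle_edges D)"
    using assms(1) arcs_subset_drawing[OF assms(2)] in_components_connected in_components_subset
    unfolding faces_def by blast+
  have "x \<in> inside (arcs curve (cycle_edges D)) \<longleftrightarrow> y \<in> inside (arcs curve (cycle_edges D))"
    if "y \<in> f" for y
    using f assms(3) that
    by (intro connected_component_not_inside) (auto simp: connected_component_def)
  then show ?thesis using assms(3) by blast
qed

text \<open>\<open>f\<close> and \<open>g\<close> are the faces of the two points from
  \<open>edge_separates\<close>. In the dual multigraph this says that each edge on a cycle has two
  distinct ends; the last clause says that a cycle separates them exactly if it uses the
  edge.\<close>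

lemma faces_at_edge:
  assumes "is_cycle E C" "e \<in> cycle_edges C"
  obtains f g where "f \<noteq> g" "{h \<in> F. e \<in> cycle_edges (boundary h)} = {f, g}"
    "\<And>D. is_cycle E D \<Longrightarrow> (f \<subseteq> inside (arcs curve (cycle_edges D)) \<longleftrightarrow>
      \<not> g \<subseteq> inside (arcs curve (cycle_edges D))) \<longleftrightarrow> e \<in> cycle_edges D"
proof -
  let ?D = "drawing V E pos curve"
  let ?I = "\<lambda>D. inside (arcs curve (cycle_edges D))"
  obtain a b where off: "a \<notin> ?D" "b \<notin> ?D"
    and sep: "\<And>D. is_cycle E D \<Longrightarrow> (a \<in> ?I D \<longleftrightarrow> b \<notin> ?I D) \<longleftrightarrow> e \<in> cycle_edges D"
    using edge_separates[OF assms] by blast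
  define f g where "f = connected_component_set (- ?D) a" and "g = connected_component_set (- ?D) b"
  have fg: "f \<in> F" "g \<in> F" "a \<in> f" "b \<in> g"
    using off by (auto simp: f_def g_def faces_def components_def)
  have eq: "h = h'" if "h \<in> F" "h' \<in> F" "x \<in> h" "x \<in> h'" for h h' x
    using that components_eq[of h "- ?D" h'] unfolding faces_def by blast
  have cross: "(f \<subseteq> ?I D \<longleftrightarrow> \<not> g \<subseteq> ?I D) \<longleftrightarrow> e \<in> cycle_edges D" if "is_cycle E D" for D
    using sep[OF that] face_subset_inside_iff[OF fg(1) that fg(3)]
      face_subset_inside_iff[OF fg(2) that fg(4)] by blast
  have neq: "f \<noteq> g" using cross[OF assms(1)] assms(2) by blast
  have "e \<in> cycle_edges (boundary h) \<longleftrightarrow> h = f \<or> h = g" if h: "h \<in> F" for h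
  proof -
    let ?A = "arcs curve (cycle_edges (boundary h))"
    have "a \<notin> ?A" "b \<notin> ?A" using off arcs_subset_drawing[OF boundary(2)[OF h]] by blast+
    then have "a \<in> outside ?A \<longleftrightarrow> a \<notin> inside ?A" "b \<in> outside ?A \<longleftrightarrow> b \<notin> inside ?A"
      using inside_Un_outside[of ?A] inside_Int_outside[of ?A] by blast+
    \<comment> \<open>As \<open>h\<close> is one of the two sides of its boundary, that boundary
      separates \<open>a\<close> from \<open>b\<close> exactly if \<open>h\<close> contains one of
      them and not the other.\<close>
    then have "e \<in> cycle_edges (boundary h) \<longleftrightarrow> (a \<in> h \<longleftrightarrow> b \<notin> h)"
      using sep[OF boundary(2)[OF h]] face_inside_or_outside[OF h] by metis
    moreover have "a \<in> h \<longleftrightarrow> h = f" "b \<in> h \<longleftrightarrow> h = g"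
      using eq[OF h fg(1)] eq[OF h fg(2)] fg by blast+
    ultimately show ?thesis using neq by blast
  qed
  then have "{h \<in> F. e \<in> cycle_edges (boundary h)} = {f, g}" using fg by blast
  then show ?thesis using that neq cross by blast
qed

text \<open>Modulo 2, a cycle is the sum of the boundaries of the faces inside it.\<close>

lemma even_on_faces_imp_even_on_cycles:
  assumes H: "\<And>f. f \<in> F \<Longrightarrow> even (card (cycle_edges (boundary f) \<inter> H))"
    and D: "is_cycle E D"
  shows "even (card (H \<inter> cycle_edges D))"
proof -
  define I where "I = {f \<in> F. f \<subseteq> inside (arcs curve (cycle_edges D))}"
  \<comment> \<open>Counts the faces inside \<open>D\<close> that have \<open>e\<close> on their
    boundary. If \<open>e\<close> lies on a cycle, it has two faces, and exactly one of them is
    inside \<open>D\<close> if and only if \<open>e\<close> is on \<open>D\<close>. An edge on no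
    cycle bounds no face.\<close>
  define k where "k e = card {f \<in> I. e \<in> cycle_edges (boundary f)}" for e
  have I: "finite I" "I \<subseteq> F" using finite_faces by (auto simp: I_def)
  have odd_k: "odd (k e) \<longleftrightarrow> e \<in> cycle_edges D" for e
  proof (cases "\<exists>C. is_cycle E C \<and> e \<in> cycle_edges C")
    case True
    then obtain C where C: "is_cycle E C" "e \<in> cycle_edges C" by blast
    obtain f g where fg: "f \<noteq> g" "{h \<in> F. e \<in> cycle_edges (boundary h)} = {f, g}"
      and cross: "\<And>D. is_cycle E D \<Longrightarrow> (f \<subseteq> inside (arcs curve (cycle_edges D)) \<longleftrightarrow>
        \<not> g \<subseteq> inside (arcs curve (cycle_edges D))) \<longleftrightarrow> e \<in> cycle_edges D"
      by (rule faces_at_edge[OF C]) (rule that)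
    have "{h \<in> I. e \<in> cycle_edges (boundary h)} =
        {h \<in> {f, g}. h \<subseteq> inside (arcs curve (cycle_edges D))}"
      unfolding fg(2)[symmetric] by (auto simp: I_def)
    also have "\<dots> = (if f \<subseteq> inside (arcs curve (cycle_edges D)) then {f} else {}) \<union>
        (if g \<subseteq> inside (arcs curve (cycle_edges D)) then {g} else {})"
      by auto
    finally show ?thesis using fg(1) cross[OF D] by (simp add: k_def split: if_splits)
  next
    case False
    then have "{h \<in> I. e \<in> cycle_edges (boundary h)} = {}" using I(2) boundary(2) by blast
    then have "k e = 0" unfolding k_def by (simp only: card.empty)
    then show ?thesis using False D by auto
  qed
  have sub: "cycle_edges C \<subseteq> E" if "is_cycle E C" for C using that by (simp add: is_cycle_def)
  \<comment> \<open>Incidences between faces inside \<open>D\<close> and edges of \<open>H\<close>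
    are counted twice. Each face contributes an even number, and an edge contributes an odd number
    exactly if it lies on \<open>D\<close>.\<close>
  have "(\<Sum>f\<in>I. card {e \<in> H \<inter> E. e \<in> cycle_edges (boundary f)}) = (\<Sum>e\<in>H \<inter> E. k e)"
    using I finite_E by (intro sum_multicount_gen) (auto simp: k_def)
  moreover have "{e \<in> H \<inter> E. e \<in> cycle_edges (boundary f)} = cycle_edges (boundary f) \<inter> H"
    if "f \<in> I" for f
    using that I(2) sub[OF boundary(2)] by blast
  ultimately have "(\<Sum>e\<in>H \<inter> E. k e) = (\<Sum>f\<in>I. card (cycle_edges (boundary f) \<inter> H))"
    by simp
  also have "even \<dots>" using H I(2) by (intro dvd_sum) blast
  finally have "even (card {e \<in> H \<inter> E. odd (k e)})"
    using finite_E by (simp add: even_sum_iff)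
  moreover have "{e \<in> H \<inter> E. odd (k e)} = H \<inter> cycle_edges D"
    using sub[OF D] by (auto simp: odd_k)
  ultimately show ?thesis by simp
qed

section \<open>The guard colouring and the final bound\<close>

lemma guard_coloring_exists:
  obtains c :: "'a \<Rightarrow> bool" where
    "\<And>f. f \<in> F \<Longrightarrow> \<exists>x y. {x, y} \<in> E \<and> {x, y} \<subseteq> set (boundary f) \<and> c x = c y"
    "\<And>f b. f \<in> F \<Longrightarrow> \<exists>x\<in>set (boundary f). c x = b"
proof -
  \<comment> \<open>Petersen's theorem is applied to the dual multigraph: its vertices are the
    faces, and the edges at a face are its four boundary edges.\<close>
  obtain H where H: "\<And>f. f \<in> F \<Longrightarrow> card (cycle_edges (boundary f) \<inter> H) = 2"
  proof (rule four_regular_two_factor[of F "\<lambda>f. cycle_edges (boundary f)"])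
    show "finite F" by (rule finite_faces)
    show "card (cycle_edges (boundary f)) = 4" if "f \<in> F" for f
      by (rule boundary_list[OF that]) (auto simp: doubleton_eq_iff)
    show "card {g \<in> F. e \<in> cycle_edges (boundary g)} = 2"
      if "f \<in> F" "e \<in> cycle_edges (boundary f)" for f e
      by (rule faces_at_edge[OF boundary(2)[OF that(1)] that(2)]) simp
  qed blast
  have "\<exists>c :: 'a \<Rightarrow> bool. \<forall>x y. {x, y} \<in> E \<longrightarrow> ({x, y} \<in> H \<longleftrightarrow> c x \<noteq> c y)"
  proof (rule even_cycles_imp_cut[OF finite_E])
    show "card e = 2" if "e \<in> E" for e using edges[OF that] by simp
    show "even (card (H \<inter> cycle_edges xs))" if "is_cycle E xs" for xs
      using that H by (intro even_on_faces_imp_even_on_cycles) auto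
  qed
  then obtain c :: "'a \<Rightarrow> bool" where c: "\<And>x y. {x, y} \<in> E \<Longrightarrow> {x, y} \<in> H \<longleftrightarrow> c x \<noteq> c y"
    by blast
  show ?thesis
  proof (rule that[of c])
    fix f assume f: "f \<in> F"
    obtain u v w z where l: "boundary f = [u, v, w, z]" "distinct [u, v, w, z]"
      "cycle_edges (boundary f) = {{u, v}, {v, w}, {w, z}, {z, u}}"
      using boundary_list[OF f] by blast
    have E: "{u, v} \<in> E" "{v, w} \<in> E" "{w, z} \<in> E" "{z, u} \<in> E"
      using boundary(2)[OF f] l(3) by (auto simp: is_cycle_def)
    have two: "card ({{u, v}, {v, w}, {w, z}, {z, u}} \<inter> H) = 2"
      using H[OF f] l(3) by simp
    show "\<exists>x y. {x, y} \<in> E \<and> {x, y} \<subseteq> set (boundary f) \<and> c x = c y"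
    proof (rule ccontr)
      assume "\<nexists>x y. {x, y} \<in> E \<and> {x, y} \<subseteq> set (boundary f) \<and> c x = c y"
      \<comment> \<open>Four colour changes around the face would put all four boundary edges into
        \<open>H\<close>, which contains only two of them. In the bichromatic part below, no change
        at all would put none there.\<close>
      then have "c u \<noteq> c v" "c v \<noteq> c w" "c w \<noteq> c z" "c z \<noteq> c u" using E l(1) by auto
      then have "{{u, v}, {v, w}, {w, z}, {z, u}} \<inter> H = {{u, v}, {v, w}, {w, z}, {z, u}}"
        using c[OF E(1)] c[OF E(2)] c[OF E(3)] c[OF E(4)] by blast
      moreover have "card {{u, v}, {v, w}, {w, z}, {z, u}} = 4"
        using l(2) by (auto simp: doubleton_eq_iff)
      ultimately show False using two by simp
    qed
    fix b
    show "\<exists>x\<in>set (boundary f). c x = b"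
    proof (rule ccontr)
      assume "\<not> (\<exists>x\<in>set (boundary f). c x = b)"
      then have "c u = c v" "c v = c w" "c w = c z" "c z = c u" unfolding l(1) by auto
      then have "{{u, v}, {v, w}, {w, z}, {z, u}} \<inter> H = {}"
        using c[OF E(1)] c[OF E(2)] c[OF E(3)] c[OF E(4)] by blast
      then show False using two by simp
    qed
  qed
qed

lemma boundary_vertex:
  assumes "f \<in> F" "v \<in> set (boundary f)"
  shows "v \<in> \<Union> E" "pos v \<in> frontier f"
proof -
  have "v \<in> \<Union> (cycle_edges (boundary f))"
    by (rule boundary_list[OF assms(1)]) (use assms(2) in auto)
  then obtain e where e: "e \<in> cycle_edges (boundary f)" "v \<in> e" by blast
  then have "e \<in> E" using boundary(2)[OF assms(1)] by (auto simp: is_cycle_def)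
  then show "v \<in> \<Union> E" "pos v \<in> frontier f"
    using e pos_in_curve boundary(4)[OF assms(1)] by (auto simp: arcs_def)
qed

end

theorem theorem2:
  fixes V :: "'a set" and E :: "'a set set"
    and pos :: "'a \<Rightarrow> complex" and curve :: "'a set \<Rightarrow> real \<Rightarrow> complex"
    and n :: nat
  assumes "quadrangulation V E pos curve" and "card V = n"
  shows "\<exists>\<Gamma>. edge_guard_set V E pos curve \<Gamma> \<and> int (card \<Gamma>) \<le> \<lfloor>real n / 3\<rfloor>"
proof -
  interpret quadrangulation V E pos curve by (rule assms(1))
  obtain c :: "'a \<Rightarrow> bool" where
    c: "\<And>f. f \<in> F \<Longrightarrow> \<exists>x y. {x, y} \<in> E \<and> {x, y} \<subseteq> set (boundary f) \<and> c x = c y"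
      "\<And>f b. f \<in> F \<Longrightarrow> \<exists>x\<in>set (boundary f). c x = b"
    using guard_coloring_exists by blast
  \<comment> \<open>The sets to be met are the vertex sets of the face boundaries; by
    \<open>boundary_vertex\<close> an edge meeting one of them guards that face.\<close>
  obtain \<Gamma> where \<Gamma>: "\<Gamma> \<subseteq> E" "3 * card \<Gamma> \<le> card V"
    "\<And>S. S \<in> (\<lambda>f. set (boundary f)) ` F \<Longrightarrow> \<exists>e\<in>\<Gamma>. e \<inter> S \<noteq> {}"
  proof (rule guard_coloring_imp_guards[of V E "(\<lambda>f. set (boundary f)) ` F" c])
    show "\<exists>x\<in>S. x \<in> \<Union> E \<and> c x = b" if S: "S \<in> (\<lambda>f. set (boundary f)) ` F" for S b
    proof -
      obtain f where f: "f \<in> F" "S = set (boundary f)" using S by blast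
      then obtain x where "x \<in> S" "c x = b" using c(2)[of f b] by blast
      then show ?thesis using boundary_vertex(1)[OF f(1)] f(2) by blast
    qed
    show "\<exists>x y. {x, y} \<in> E \<and> {x, y} \<subseteq> S \<and> c x = c y" if "S \<in> (\<lambda>f. set (boundary f)) ` F" for S
      using that c(1) by (elim imageE) simp
  qed (simp_all add: finite_vertices edges)
  have "\<exists>e\<in>\<Gamma>. guards pos e f" if f: "f \<in> F" for f
  proof -
    obtain e v where "e \<in> \<Gamma>" "v \<in> e" "v \<in> set (boundary f)" using \<Gamma>(3)[OF imageI[OF f]] by blast
    then show ?thesis using boundary_vertex(2)[OF f] unfolding guards_def by blast
  qed
  then have "edge_guard_set V E pos curve \<Gamma>"
    using \<Gamma>(1) unfolding edge_guard_set_def by blast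
  moreover have "int (card \<Gamma>) \<le> \<lfloor>real n / 3\<rfloor>"
    using \<Gamma>(2) assms(2) by (simp add: le_floor_iff)
  ultimately show ?thesis by blast
qed

end
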